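(* The variety of EM fixed points in the polytope $\Theta$ is defined by the equations $$A\star (R\cdot B^T)=0,\qquad B\star (A^T\cdot R)=0,$$ where $R$ is the gradient matrix of the log-likelihood function and $\star$ denotes the Hadamard (entrywise) product. The subset of EM fixed points that are critical points is defined by $R\cdot B^T=0$ and $A^T\cdot R=0$.
   Context: $m,n,r\ge1$ are integers, $\Delta_d$ is the standard $d$-dimensional probability simplex, and $U=(u_{ij})$ is a fixed positive $m\times n$ data matrix with $u_{++}=\sum_{i,j}u_{ij}$. The parameter polytope is $\Theta=(\Delta_{m-1})^r\times\Delta_{r-1}\times(\Delta_{n-1})^r$; a point is a triple $(A,\Lambda,B)$ with $A=(a_{ik})$ a nonnegative $m\times r$ matrix whose columns sum to $1$, $\Lambda=\mathrm{diag}(\lambda_1,\dots,\lambda_r)$ nonnegative with $\sum_k\lambda_k=1$, and $B=(b_{kj})$ a nonnegative $r\times n$ matrix whose rows sum to $1$. The parameters $\lambda_k$ are taken to be positive. Put $P=A\Lambda B$, i.e. $p_{ij}=\sum_k a_{ik}\lambda_k b_{kj}$; the model $\mathcal M\subset\Delta_{mn-1}$ is the set of all such $P$. The log-likelihood function is $\ell_U(P)=\sum_{i,j}u_{ij}\log p_{ij}$, and $R=(r_{ij})$ is the $m\times n$ matrix with entries $r_{ij}=u_{++}-u_{ij}/p_{ij}$. The EM algorithm for $(U,r)$ starts at a point of $\Theta$ and iterates the following. E-step: $v_{ikj}:=\frac{a_{ik}\lambda_k b_{kj}}{\sum_{l}a_{il}\lambda_l b_{lj}}u_{ij}$. M-step: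 $\lambda_k:=\frac{1}{u_{++}}\sum_{i,j}v_{ikj}$, then $a_{ik}:=\frac{1}{u_{++}\lambda_k}\sum_j v_{ikj}$ and $b_{kj}:=\frac{1}{u_{++}\lambda_k}\sum_i v_{ikj}$. If $p_{ij}=0$ (so that $a_{ik}b_{kj}=0$ for all $k$), the expression $a_{ik}b_{kj}/p_{ij}$ is considered to be $0$. An EM fixed point for $U$ is any point $(A,\Lambda,B)\in\Theta$ to which the EM algorithm can converge; equivalently, a point that remains fixed after one E-step and M-step. Let $\mathcal V$ be the variety of real $m\times n$ matrices $P$ of rank $\le r$ with $\sum_{i,j}p_{ij}=1$. A matrix $P$ is a critical point of $\ell_U$ if $P\in\mathcal M$, $\operatorname{rank}(P)=r$ (i.e. $P$ is a nonsingular point of $\mathcal V$), and the gradient of $\ell_U$ at $P$ is orthogonal to the tangent space $T_P(\mathcal V)$. An EM fixed point $(A,\Lambda,B)$ is called critical if $P=A\Lambda B$ is.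
   Formalization: The second sentence is proved with the condition rank(AΛB) = r added to the equations R·B^T = 0 and A^T·R = 0; without it the claim fails, e.g. r = 2 with equal columns of A and equal rows of B given by the normalised marginals of U. *)

theory Defs
  imports "HOL-Analysis.Analysis"
begin

text \<open>
  The integers m, n, r are the cardinalities of the finite index types 'm, 'n, 'r.
  A parameter is a triple (A, \<lambda>, B), where the vector \<lambda> stands for the diagonal matrix
  \<Lambda> = diag(\<lambda>).
\<close>

type_synonym ('m, 'r, 'n) param = "(real^'r^'m) \<times> (real^'r) \<times> (real^'n^'r)"

definition prob_simplex :: "(real^'d) set" where
  "prob_simplex = {x. (\<forall>i. 0 \<le> x $ i) \<and> (\<Sum>i\<in>UNIV. x $ i) = 1}"

definition Theta :: "('m::finite, 'r::finite, 'n::finite) param set" where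
  "Theta = {(A, lam, B). (\<forall>k. column k A \<in> prob_simplex) \<and> lam \<in> prob_simplex \<and>
                         (\<forall>k. row k B \<in> prob_simplex)}"

definition Theta_pos :: "('m::finite, 'r::finite, 'n::finite) param set" where
  "Theta_pos = {(A, lam, B). (A, lam, B) \<in> Theta \<and> (\<forall>k. 0 < lam $ k)}"

definition diag :: "real^'r \<Rightarrow> real^'r^'r" where
  "diag lam = (\<chi> k l. if k = l then lam $ k else 0)"

definition param_matrix :: "('m::finite, 'r::finite, 'n::finite) param \<Rightarrow> real^'n^'m" where
  "param_matrix = (\<lambda>(A, lam, B). A ** diag lam ** B)"

definition model :: "'r::finite itself \<Rightarrow> (real^'n::finite^'m::finite) set" where
  "model _ = param_matrix ` (Theta :: ('m, 'r, 'n) param set)"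

definition total :: "real^'n^'m \<Rightarrow> real" where
  "total U = (\<Sum>i\<in>UNIV. \<Sum>j\<in>UNIV. U $ i $ j)"

definition loglik :: "real^'n^'m \<Rightarrow> real^'n^'m \<Rightarrow> real" where
  "loglik U P = (\<Sum>i\<in>UNIV. \<Sum>j\<in>UNIV. U $ i $ j * ln (P $ i $ j))"

text \<open>
  Division by zero yields zero. In \<open>e_step\<close> this is the convention that the quotient of
  \<open>a_ik b_kj\<close> by \<open>p_ij\<close> is 0 when \<open>p_ij = 0\<close>. In \<open>grad_matrix\<close> the value at such an entry is
  immaterial for the Hadamard equations, because \<open>r_ij\<close> occurs there only in the products
  \<open>a_ik r_ij b_kj\<close>, and \<open>a_ik b_kj = 0\<close> when \<open>p_ij = 0\<close> and all \<open>\<lambda>_k > 0\<close>.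
\<close>

definition grad_matrix :: "real^'n^'m \<Rightarrow> real^'n^'m \<Rightarrow> real^'n^'m" where
  "grad_matrix U P = (\<chi> i j. total U - U $ i $ j / P $ i $ j)"

definition e_step ::
  "real^'n^'m \<Rightarrow> ('m::finite, 'r::finite, 'n::finite) param \<Rightarrow> 'm \<Rightarrow> 'r \<Rightarrow> 'n \<Rightarrow> real" where
  "e_step U = (\<lambda>(A, lam, B) i k j.
     (A $ i $ k * lam $ k * B $ k $ j) / (\<Sum>l\<in>UNIV. A $ i $ l * lam $ l * B $ l $ j) * U $ i $ j)"

definition m_step ::
  "real^'n^'m \<Rightarrow> ('m \<Rightarrow> 'r \<Rightarrow> 'n \<Rightarrow> real) \<Rightarrow> ('m::finite, 'r::finite, 'n::finite) param" where
  "m_step U v =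
     (let lam = (\<chi> k. 1 / total U * (\<Sum>i\<in>UNIV. \<Sum>j\<in>UNIV. v i k j)) in
       ((\<chi> i k. 1 / (total U * lam $ k) * (\<Sum>j\<in>UNIV. v i k j)),
        lam,
        (\<chi> k j. 1 / (total U * lam $ k) * (\<Sum>i\<in>UNIV. v i k j))))"

definition em_step ::
  "real^'n^'m \<Rightarrow> ('m::finite, 'r::finite, 'n::finite) param \<Rightarrow> ('m, 'r, 'n) param" where
  "em_step U \<theta> = m_step U (e_step U \<theta>)"

text \<open>The points (with positive \<open>\<lambda>_k\<close>) to which the EM algorithm can converge.\<close>

definition em_fixed_point ::
  "real^'n^'m \<Rightarrow> ('m::finite, 'r::finite, 'n::finite) param \<Rightarrow> bool" where
  "em_fixed_point U \<theta> \<longleftrightarrow>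
     \<theta> \<in> Theta_pos \<and> (\<exists>\<theta>0\<in>Theta_pos. (\<lambda>t. (em_step U ^^ t) \<theta>0) \<longlonglongrightarrow> \<theta>)"

definition rank_variety :: "nat \<Rightarrow> (real^'n^'m) set" where
  "rank_variety r = {P. rank P \<le> r \<and> (\<Sum>i\<in>UNIV. \<Sum>j\<in>UNIV. P $ i $ j) = 1}"

text \<open>
  The tangent space of a variety: the common kernel of the differentials at P of all
  polynomials in the vanishing ideal of V.
\<close>

definition tangent_space :: "'a::euclidean_space set \<Rightarrow> 'a \<Rightarrow> 'a set" where
  "tangent_space V P =
     {X. \<forall>f. real_polynomial_function f \<and> (\<forall>Q\<in>V. f Q = 0) \<longrightarrow> frechet_derivative f (at P) X = 0}"

text \<open>
  The gradient is taken in the ambient matrix space. It does not exist if some \<open>p_ij = 0\<close>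
  (for positive U), so that critical points have positive entries.
\<close>

definition critical_point ::
  "'r::finite itself \<Rightarrow> real^'n::finite^'m::finite \<Rightarrow> real^'n^'m \<Rightarrow> bool" where
  "critical_point R U P \<longleftrightarrow>
     P \<in> model R \<and> rank P = CARD('r) \<and>
     (\<exists>G. (GDERIV (loglik U) P :> G) \<and>
          (\<forall>X \<in> tangent_space (rank_variety CARD('r)) P. orthogonal G X))"

definition critical_param ::
  "real^'n^'m \<Rightarrow> ('m::finite, 'r::finite, 'n::finite) param \<Rightarrow> bool" where
  "critical_param U \<theta> \<longleftrightarrow> critical_point TYPE('r) U (param_matrix \<theta>)"

text \<open>Multiplication of the type \<open>vec\<close> is componentwise, hence entrywise on matrices.\<close>

abbreviation hadamard :: "real^'n^'m \<Rightarrow> real^'n^'m \<Rightarrow> real^'n^'m" (infixl "\<star>" 70) where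
  "A \<star> B \<equiv> A * B"

end

theory Submission
  imports Defs
begin

text \<open>
  A limit of EM iterates has \<open>P > 0\<close>, so the EM step is continuous there and the limit is a
  fixed point; the fixed point equations are \<open>a_ik \<Sum>\<^sub>j u_ij b_kj / p_ij = u_++ a_ik\<close> and
  their counterparts for B, which are the Hadamard equations because the \<open>b_kj\<close> sum to 1 over j.
  Solutions of the Hadamard equations also have \<open>P > 0\<close>, so the gradient \<open>G = (u_ij / p_ij)\<close>
  of the log-likelihood exists, and \<open>R = u_++ J - G\<close> for the all-ones matrix J.
  The tangent space at P contains \<open>A Y - s P\<close> and \<open>Z B - t P\<close>, where s and t are the
  entry sums of \<open>A Y\<close> and \<open>Z B\<close>; since \<open>\<langle>G, P\<rangle> = u_++\<close>, orthogonality of G to these is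
  orthogonality of R to all \<open>A Y\<close> and \<open>Z B\<close>. Conversely, if P has rank r, then a tangent vector
  X satisfies \<open>x\<^sup>T X y = 0\<close> whenever \<open>A\<^sup>T x = 0\<close> and \<open>B y = 0\<close>, and this makes it orthogonal to
  every R with \<open>R B\<^sup>T = 0\<close> and \<open>A\<^sup>T R = 0\<close>.
\<close>

subsection \<open>Matrices and the entrywise inner product\<close>

lemma inner_matrix: "X \<bullet> Y = (\<Sum>i\<in>UNIV. \<Sum>j\<in>UNIV. X $ i $ j * Y $ i $ j)"
  for X Y :: "real^'n^'m"
  by (simp add: inner_vec_def)

text \<open>Adjointness for the entrywise inner product: it turns orthogonality to all
  \<open>Y ** B\<close> into an equation for \<open>X ** transpose B\<close>.\<close>

lemma inner_matrix_mul_right: "X \<bullet> (Y ** B) = (X ** transpose B) \<bullet> Y"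
  for X :: "real^'n^'m" and Y :: "real^'r^'m"
proof -
  have "(\<Sum>j\<in>UNIV. \<Sum>k\<in>UNIV. X $ i $ j * (Y $ i $ k * B $ k $ j)) =
        (\<Sum>k\<in>UNIV. \<Sum>j\<in>UNIV. X $ i $ j * B $ k $ j * Y $ i $ k)" for i
    by (subst sum.swap) (simp add: mult_ac)
  then show ?thesis
    by (simp add: inner_matrix matrix_matrix_mult_def transpose_def sum_distrib_left sum_distrib_right)
qed

lemma inner_transpose: "transpose X \<bullet> transpose Y = X \<bullet> Y" for X Y :: "real^'n^'m"
  unfolding inner_matrix transpose_def by (subst sum.swap) simp

lemma inner_matrix_mul_left: "X \<bullet> (A ** Y) = (transpose A ** X) \<bullet> Y"
  for X :: "real^'n^'m" and Y :: "real^'n^'r"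
proof -
  have "X \<bullet> (A ** Y) = transpose X \<bullet> (transpose Y ** transpose A)"
    by (metis inner_transpose matrix_transpose_mul)
  also have "\<dots> = (transpose X ** A) \<bullet> transpose Y"
    by (simp add: inner_matrix_mul_right)
  also have "\<dots> = (transpose A ** X) \<bullet> Y"
    by (metis inner_transpose matrix_transpose_mul transpose_transpose)
  finally show ?thesis .
qed

lemma matrix_add_rdistrib: "(B + C) ** A = B ** A + C ** A" for A :: "real^'n^'m"
  by (simp add: vec_eq_iff matrix_matrix_mult_def distrib_right sum.distrib)

lemma matrix_diff_ldistrib: "A ** (B - C) = A ** B - A ** C" for A :: "real^'n^'m"
  by (metis add_diff_cancel diff_add_cancel matrix_add_ldistrib)

lemma matrix_diff_rdistrib: "(B - C) ** A = B ** A - C ** A" for A :: "real^'n^'m"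
  by (simp add: vec_eq_iff matrix_matrix_mult_def left_diff_distrib sum_subtractf)

lemma total_eq_inner: "total X = X \<bullet> (\<chi> i j. 1)"
  by (simp add: total_def inner_matrix)

lemma transpose_0: "transpose (0::real^'n^'m) = 0"
  by (simp add: vec_eq_iff transpose_def)

lemma matrix_mult_row_0: "X $ i = 0 \<Longrightarrow> (X ** Y) $ i = 0" for X :: "real^'n^'m"
  by (simp add: vec_eq_iff matrix_matrix_mult_def)

lemma transpose_mul_self_eq_0:
  fixes A :: "real^'r^'m"
  assumes "inj ((*v) A)" "transpose A *v (A *v x) = 0"
  shows "x = 0"
proof -
  have "(A *v x) \<bullet> (A *v x) = 0"
    using assms(2) by (metis dot_lmul_matrix inner_zero_right inner_commute transpose_matrix_vector)
  then have "A *v x = A *v 0" by simp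
  then show ?thesis using assms(1) by (meson injD)
qed

text \<open>The witness is the orthogonal projection \<open>mat 1 - A ** H ** transpose A\<close>
  onto the kernel of \<open>transpose A\<close>, with \<open>H\<close> the inverse of the Gram
  matrix \<open>transpose A ** A\<close>.\<close>

lemma projection_onto_left_kernel:
  fixes A :: "real^'r^'m"
  assumes "inj ((*v) A)"
  obtains S :: "real^'m^'m" where "transpose A ** S = 0"
    "\<And>R :: real^'n^'m. transpose A ** R = 0 \<Longrightarrow> S ** R = R"
proof -
  have "\<forall>x. (transpose A ** A) *v x = 0 \<longrightarrow> x = 0"
    using transpose_mul_self_eq_0[OF assms] by (simp add: matrix_vector_mul_assoc)
  then obtain H where "H ** (transpose A ** A) = mat 1"
    using matrix_left_invertible_ker by blast
  then have H: "(transpose A ** A) ** H = mat 1"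
    using matrix_left_right_inverse by blast
  show thesis
  proof
    show "transpose A ** (mat 1 - A ** H ** transpose A) = 0"
      using H by (simp add: matrix_diff_ldistrib matrix_mul_assoc)
    fix R :: "real^'n^'m" assume "transpose A ** R = 0"
    then show "(mat 1 - A ** H ** transpose A) ** R = R"
      by (simp add: matrix_diff_rdistrib flip: matrix_mul_assoc)
  qed
qed

text \<open>Projecting onto the two kernels fixes \<open>R\<close> from both sides:
  \<open>R = S ** R ** transpose S'\<close>. By adjointness the projections move over to
  \<open>X\<close>, and the columns of \<open>S\<close> and \<open>S'\<close> lie in the kernels,
  where the bilinear form of \<open>X\<close> vanishes.\<close>

lemma inner_eq_0_of_kernels:
  fixes A :: "real^'r^'m" and B :: "real^'n^'r" and R X :: "real^'n^'m"
  assumes A: "inj ((*v) A)" and B: "inj ((*v) (transpose B))"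
    and RB: "R ** transpose B = 0" and AR: "transpose A ** R = 0"
    and X: "\<And>x y. transpose A *v x = 0 \<Longrightarrow> B *v y = 0 \<Longrightarrow> x \<bullet> (X *v y) = 0"
  shows "R \<bullet> X = 0"
proof -
  obtain S :: "real^'m^'m" where S: "transpose A ** S = 0" "S ** R = R"
    using projection_onto_left_kernel[OF A] AR by metis
  obtain S' :: "real^'n^'n" where S': "B ** S' = 0" "S' ** transpose R = transpose R"
    using projection_onto_left_kernel[OF B] RB
    by (metis matrix_transpose_mul transpose_transpose transpose_0)
  have "R ** transpose S' = R"
    by (metis S'(2) matrix_transpose_mul transpose_transpose)
  then have "R \<bullet> (transpose S ** X ** S') = R \<bullet> (transpose S ** X)"
    by (simp add: inner_matrix_mul_right)
  also have "\<dots> = R \<bullet> X"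
    using S(2) by (simp add: inner_matrix_mul_left)
  finally have "R \<bullet> X = R \<bullet> (transpose S ** X ** S')" ..
  also have "transpose S ** X ** S' = 0"
  proof -
    have "(transpose S ** X ** S') $ i $ j = column i S \<bullet> (X *v column j S')" for i j
      unfolding matrix_mul_assoc[symmetric]
      by (simp add: column_def matrix_vector_mult_def inner_vec_def
          matrix_matrix_mult_def transpose_def)
    moreover have "transpose A *v column i S = 0" "B *v column j S' = 0" for i j
      using S(1) S'(1)
      by (simp_all add: vec_eq_iff column_def matrix_vector_mult_def matrix_matrix_mult_def)
    ultimately show ?thesis
      using X by (simp add: vec_eq_iff)
  qed
  finally show ?thesis by simp
qed

subsection \<open>Tangent spaces of determinantal varieties\<close>

lemma real_polynomial_along_line:
  assumes "real_polynomial_function f"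
  shows "((\<lambda>t. f (P + t *\<^sub>R X)) has_field_derivative frechet_derivative f (at P) X) (at 0)"
proof -
  have diff: "f differentiable at P"
    using assms by (rule differentiable_at_real_polynomial_function)
  then have "(f has_derivative frechet_derivative f (at P)) (at (P + 0 *\<^sub>R X))"
    by (simp add: frechet_derivative_works)
  moreover have "((\<lambda>t. P + t *\<^sub>R X) has_derivative (\<lambda>t. t *\<^sub>R X)) (at 0)"
    by (auto intro!: derivative_eq_intros)
  ultimately have "((\<lambda>t. f (P + t *\<^sub>R X)) has_derivative
      (\<lambda>t. frechet_derivative f (at P) (t *\<^sub>R X))) (at 0)"
    using diff_chain_at[of "\<lambda>t. P + t *\<^sub>R X" "\<lambda>t. t *\<^sub>R X" 0 f] by (simp add: o_def)
  then show ?thesis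
    using linear_cmul[OF linear_frechet_derivative[OF diff]]
    by (simp add: has_field_derivative_def mult_commute_abs)
qed

lemma line_in_tangent_space:
  assumes "\<And>t. P + t *\<^sub>R X \<in> V"
  shows "X \<in> tangent_space V P"
proof -
  have "frechet_derivative f (at P) X = 0"
    if f: "real_polynomial_function f" "\<forall>Q\<in>V. f Q = 0" for f
  proof -
    have "((\<lambda>t. f (P + t *\<^sub>R X)) has_field_derivative 0) (at 0)"
      using f(2) assms by simp
    then show ?thesis
      using real_polynomial_along_line[OF f(1)] DERIV_unique by blast
  qed
  then show ?thesis by (simp add: tangent_space_def)
qed

lemma tangent_space_directional:
  assumes X: "X \<in> tangent_space V P" and f: "real_polynomial_function f" "\<And>Q. Q \<in> V \<Longrightarrow> f Q = 0"
  shows "((\<lambda>t. f (P + t *\<^sub>R X)) has_field_derivative 0) (at 0)"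
  using real_polynomial_along_line[OF f(1), of P X] X f by (simp add: tangent_space_def)

text \<open>The polynomial \<open>total Q - 1\<close> vanishes on the variety, and its derivative
  along \<open>X\<close> is \<open>total X\<close>.\<close>

lemma tangent_rank_variety_total:
  assumes "X \<in> tangent_space (rank_variety r) P"
  shows "total X = 0"
proof -
  have "bounded_linear (\<lambda>Q::real^'a^'b. Q \<bullet> (\<chi> i j. 1))"
    by (rule bounded_linear_inner_left)
  then have "real_polynomial_function (\<lambda>Q::real^'a^'b. total Q - 1)"
    unfolding total_eq_inner
    by (intro real_polynomial_function_diff real_polynomial_function.intros(1,2))
  moreover have "total Q - 1 = 0" if "Q \<in> rank_variety r" for Q :: "real^'a^'b"
    using that by (simp add: rank_variety_def total_def)
  ultimately have "((\<lambda>t. total (P + t *\<^sub>R X) - 1) has_field_derivative 0) (at 0)"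
    by (rule tangent_space_directional[OF assms])
  moreover have "((\<lambda>t. total (P + t *\<^sub>R X) - 1) has_field_derivative total X) (at 0)"
    unfolding total_eq_inner inner_add_left inner_scaleR_left
    by (auto intro!: derivative_eq_intros)
  ultimately show ?thesis
    using DERIV_unique by blast
qed

text \<open>
  The polynomial \<open>det (M Q N)\<close>, with M the transpose of A bordered by x and N the transpose of B
  bordered by y, vanishes on matrices of rank at most r. Along \<open>P + t X\<close> a factor t splits off
  the border row, and the cofactor at \<open>t = 0\<close> is block triangular with an invertible block and
  the corner entry \<open>x\<^sup>T X y\<close>.
\<close>

lemma tangent_rank_variety_kernels:
  fixes A :: "real^'r^'m" and D :: "real^'r^'r" and B :: "real^'n^'r"
  assumes A: "inj ((*v) A)" and D: "inj ((*v) D)" and B: "inj ((*v) (transpose B))"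
    and X: "X \<in> tangent_space (rank_variety CARD('r)) (A ** D ** B)"
    and x: "transpose A *v x = 0" and y: "B *v y = 0"
  shows "x \<bullet> (X *v y) = 0"
proof (rule ccontr)
  assume xy: "x \<bullet> (X *v y) \<noteq> 0"
  define P where "P = A ** D ** B"
  \<comment> \<open>The bordered matrices are indexed by \<open>'r option\<close>, which has one
    element more than \<open>'r\<close>; \<open>None\<close> is the border.\<close>
  define M :: "real^'m^'r option"
    where "M = (\<chi> k. case k of None \<Rightarrow> x | Some k \<Rightarrow> column k A)"
  define N :: "real^'r option^'n"
    where "N = (\<chi> j k. case k of None \<Rightarrow> y $ j | Some k \<Rightarrow> B $ k $ j)"
  define f where "f Q = det (M ** Q ** N)" for Q :: "real^'n^'m"
  \<comment> \<open>\<open>Z t\<close> is \<open>M ** (P + t *\<^sub>R X) ** N\<close> with the row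
    \<open>None\<close> divided by t, a form that makes sense at t = 0. That row has no constant
    term because \<open>transpose A *v x = 0\<close>.\<close>
  define Z where "Z t = (\<chi> k. if k = None then (M ** X ** N) $ k
                              else (M ** P ** N) $ k + t *s (M ** X ** N) $ k)" for t
  define d where "d t = det (Z t)" for t
  have entry: "(M ** Q ** N) $ k $ l = (\<Sum>j\<in>UNIV. (\<Sum>i\<in>UNIV. M $ k $ i * Q $ i $ j) * N $ j $ l)"
    for Q k l by (simp add: matrix_matrix_mult_def)
  have poly: "real_polynomial_function f"
  proof -
    have "real_polynomial_function (\<lambda>Q::real^'n^'m. Q $ i $ j)" for i j
      by (intro real_polynomial_function.intros(1) bounded_linear_compose[OF bounded_linear_vec_nth]
          bounded_linear_vec_nth)
    then show ?thesis
      unfolding f_def det_def entry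
      by (intro real_polynomial_function_sum real_polynomial_function_prod
          real_polynomial_function.intros(2,4)) auto
  qed
  have vanish: "f Q = 0" if "Q \<in> rank_variety CARD('r)" for Q
  proof -
    have "rank (M ** Q ** N) \<le> rank Q"
      by (meson order_trans rank_mul_le_left rank_mul_le_right)
    also have "\<dots> < CARD('r option)"
      using that by (simp add: rank_variety_def)
    finally show ?thesis
      by (simp add: f_def det_eq_0_rank)
  qed
  have M_mult: "(M *v z) $ Some k = (transpose A *v z) $ k" "(M *v z) $ None = x \<bullet> z" for z k
    unfolding M_def matrix_vector_mult_def by (simp_all add: transpose_def column_def inner_vec_def)
  have MPN: "M ** P ** N = (M ** A) ** D ** (B ** N)"
    by (simp add: P_def matrix_mul_assoc)
  have row0: "(M ** P ** N) $ None = 0"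
  proof -
    have "(M ** A) $ None = 0"
      using x by (simp add: vec_eq_iff M_def matrix_matrix_mult_def matrix_vector_mult_def
          transpose_def mult.commute)
    then have "((M ** A) ** D ** (B ** N)) $ None = 0"
      by (metis matrix_mult_row_0)
    then show ?thesis
      by (simp only: MPN)
  qed
  have f_line: "f (P + t *\<^sub>R X) = t * d t" for t
  proof -
    have "M ** (P + t *\<^sub>R X) ** N = M ** P ** N + t *\<^sub>R (M ** X ** N)"
      by (simp add: matrix_add_ldistrib matrix_add_rdistrib matrix_scalar_ac scalar_matrix_assoc)
    also have "\<dots> = (\<chi> k. if k = None then t *s (M ** X ** N) $ k
                       else (M ** P ** N) $ k + t *s (M ** X ** N) $ k)"
      using row0 by (simp add: vec_eq_iff)
    finally show ?thesis
      by (simp add: f_def d_def Z_def det_row_mul)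
  qed
  \<comment> \<open>The difference quotient of \<open>f\<close> along the line equals
    \<open>d t\<close> away from 0, and its limit is the derivative, which is 0 for a tangent
    vector.\<close>
  have "((\<lambda>t. t * d t / t) \<longlongrightarrow> 0) (at 0)"
    using tangent_space_directional[OF X poly vanish]
    by (simp add: has_field_derivative_iff f_line flip: P_def)
  then have "(d \<longlongrightarrow> 0) (at 0)"
    by (rule Lim_transform_eventually) (simp add: eventually_at_filter)
  moreover have "(d \<longlongrightarrow> d 0) (at 0)"
  proof -
    have "((\<lambda>t. Z t $ k $ l) \<longlongrightarrow> Z 0 $ k $ l) (at 0)" for k l
    proof (cases k)
      case (Some k')
      have "((\<lambda>t. (M ** P ** N) $ k $ l + t * (M ** X ** N) $ k $ l)
          \<longlongrightarrow> (M ** P ** N) $ k $ l + 0 * (M ** X ** N) $ k $ l) (at 0)"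
        by (intro tendsto_intros)
      then show ?thesis
        using Some by (simp add: Z_def)
    qed (simp add: Z_def)
    then show ?thesis
      unfolding d_def det_def by (intro tendsto_sum tendsto_mult tendsto_const tendsto_prod)
  qed
  ultimately have "d 0 = 0"
    using tendsto_unique[OF trivial_limit_at] by blast
  moreover have "d 0 \<noteq> 0"
  proof -
    define T where "T = (\<chi> k. if k = None then (M ** X ** N) $ k else (M ** P ** N) $ k)"
    \<comment> \<open>\<open>T\<close> is \<open>Z 0\<close>. The rows \<open>Some k\<close> give
      \<open>B *v (N *v w) = 0\<close>, which with \<open>B *v y = 0\<close> kills the part
      \<open>u\<close> of \<open>w\<close>; the row \<open>None\<close> then reads
      \<open>w $ None * (x \<bullet> (X *v y)) = 0\<close>.\<close>
    have "w = 0" if w: "T *v w = 0" for w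
    proof -
      have T_mult: "(T *v w) $ k =
          (if k = None then (M ** X ** N *v w) $ k else (M ** P ** N *v w) $ k)" for k
        by (simp add: T_def matrix_vector_mult_def)
      define u where "u = (\<chi> k. w $ Some k)"
      have Nw: "N *v w = transpose B *v u + w $ None *s y"
        by (simp add: vec_eq_iff N_def u_def matrix_vector_mult_def transpose_def UNIV_option_conv
            sum.reindex mult.commute)
      have "(M ** P ** N *v w) $ Some k = 0" for k
        using T_mult[of "Some k"] by (simp add: w)
      moreover have "(M ** P ** N *v w) $ Some k = (transpose A *v (A *v (D *v (B *v (N *v w))))) $ k" for k
        by (simp only: P_def matrix_vector_mul_assoc[symmetric] M_mult)
      ultimately have "transpose A *v (A *v (D *v (B *v (N *v w)))) = 0"
        by (simp add: vec_eq_iff)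
      then have "D *v (B *v (N *v w)) = D *v 0"
        using transpose_mul_self_eq_0[OF A] by simp
      then have "B *v (N *v w) = 0"
        using D by (meson injD)
      then have "B *v (transpose B *v u) = 0"
        using y by (simp add: Nw matrix_vector_right_distrib scalar_mult_eq_scaleR matrix_vector_mult_scaleR)
      then have u0: "u = 0"
        using transpose_mul_self_eq_0[OF B] by simp
      have "(M ** X ** N *v w) $ None = 0"
        using T_mult[of None] by (simp add: w)
      moreover have "(M ** X ** N *v w) $ None = x \<bullet> (X *v (N *v w))"
        by (simp only: matrix_vector_mul_assoc[symmetric] M_mult)
      ultimately have "w $ None = 0"
        using xy by (simp add: Nw u0 scalar_mult_eq_scaleR matrix_vector_mult_scaleR)
      moreover have "w $ Some k = 0" for k
        using u0 by (simp add: u_def vec_eq_iff)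
      ultimately show "w = 0"
        by (metis (no_types, lifting) option.exhaust vec_eq_iff zero_index)
    qed
    then have "invertible T"
      by (simp add: invertible_left_inverse matrix_left_invertible_ker)
    moreover have "d 0 = det T"
      by (simp add: d_def Z_def T_def cong: if_cong)
    ultimately show ?thesis
      by (simp add: invertible_det_nz)
  qed
  ultimately show False by simp
qed

subsection \<open>The likelihood equations\<close>

lemma param_matrix_nth:
  "param_matrix (A, lam, B) $ i $ j = (\<Sum>k\<in>UNIV. A $ i $ k * lam $ k * B $ k $ j)"
  by (simp add: param_matrix_def diag_def matrix_matrix_mult_def if_distrib cong: if_cong)

lemma Theta_pos_iff:
  "(A, lam, B) \<in> Theta_pos \<longleftrightarrow>
     (\<forall>i k. 0 \<le> A $ i $ k) \<and> (\<forall>k. (\<Sum>i\<in>UNIV. A $ i $ k) = 1) \<and>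
     (\<forall>k. 0 < lam $ k) \<and> (\<Sum>k\<in>UNIV. lam $ k) = 1 \<and>
     (\<forall>k j. 0 \<le> B $ k $ j) \<and> (\<forall>k. (\<Sum>j\<in>UNIV. B $ k $ j) = 1)"
  by (auto simp: Theta_pos_def Theta_def prob_simplex_def column_def row_def intro: less_imp_le)

lemma total_param_matrix:
  assumes "(A, lam, B) \<in> Theta_pos"
  shows "total (param_matrix (A, lam, B)) = 1"
proof -
  have "total (param_matrix (A, lam, B)) =
        (\<Sum>i\<in>UNIV. \<Sum>k\<in>UNIV. \<Sum>j\<in>UNIV. A $ i $ k * lam $ k * B $ k $ j)"
    unfolding total_def param_matrix_nth by (intro sum.cong sum.swap refl)
  also have "\<dots> = (\<Sum>i\<in>UNIV. \<Sum>k\<in>UNIV. A $ i $ k * lam $ k)"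
    using assms by (simp add: Theta_pos_iff flip: sum_distrib_left)
  also have "\<dots> = (\<Sum>k\<in>UNIV. lam $ k)"
    using assms by (subst sum.swap) (simp add: Theta_pos_iff flip: sum_distrib_right)
  finally show ?thesis
    using assms by (simp add: Theta_pos_iff)
qed

lemma grad_matrix_mul_nth:
  assumes "(\<Sum>j\<in>UNIV. B $ k $ j) = 1"
  shows "(grad_matrix U P ** transpose B) $ i $ k =
         total U - (\<Sum>j\<in>UNIV. U $ i $ j / P $ i $ j * B $ k $ j)"
  using assms
  by (simp add: grad_matrix_def matrix_matrix_mult_def transpose_def left_diff_distrib sum_subtractf
      flip: sum_distrib_left)

lemma mul_grad_matrix_nth:
  assumes "(\<Sum>i\<in>UNIV. A $ i $ k) = 1"
  shows "(transpose A ** grad_matrix U P) $ k $ j =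
         total U - (\<Sum>i\<in>UNIV. U $ i $ j / P $ i $ j * A $ i $ k)"
  using assms
  by (simp add: grad_matrix_def matrix_matrix_mult_def transpose_def right_diff_distrib sum_subtractf
      mult.commute flip: sum_distrib_left)

text \<open>
  Pairing the Hadamard equations with \<open>\<lambda>\<close> gives \<open>\<langle>R, P\<rangle> = 0\<close>; since \<open>\<langle>R, P\<rangle>\<close> is the sum of
  the \<open>u_ij\<close> with \<open>p_ij = 0\<close>, the junk entries of the gradient matrix do not occur.
\<close>

lemma hadamard_imp_positive:
  fixes U :: "real^'n^'m" and A :: "real^'r^'m"
  assumes U: "\<And>i j. 0 < U $ i $ j" and \<theta>: "(A, lam, B) \<in> Theta_pos"
    and eq: "A \<star> (grad_matrix U (param_matrix (A, lam, B)) ** transpose B) = 0"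
  shows "0 < param_matrix (A, lam, B) $ i $ j"
proof (rule ccontr)
  let ?P = "param_matrix (A, lam, B)"
  let ?R = "grad_matrix U ?P"
  assume "\<not> 0 < ?P $ i $ j"
  moreover have "0 \<le> ?P $ i $ j"
    using \<theta> by (auto simp: param_matrix_nth Theta_pos_iff less_imp_le intro!: sum_nonneg mult_nonneg_nonneg)
  ultimately have P0: "?P $ i $ j = 0" by simp
  have "?R \<bullet> ?P = (?R ** transpose B) \<bullet> (A ** diag lam)"
    by (simp add: param_matrix_def inner_matrix_mul_right)
  also have "\<dots> = (\<Sum>i\<in>UNIV. \<Sum>k\<in>UNIV. (A \<star> (?R ** transpose B)) $ i $ k * lam $ k)"
    by (simp add: inner_matrix matrix_matrix_mult_def[of A] diag_def if_distrib mult_ac cong: if_cong)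
  also have "\<dots> = 0"
    using eq by simp
  finally have "?R \<bullet> ?P = 0" .
  \<comment> \<open>An entry with \<open>?P $ i $ j = 0\<close> contributes 0 to the pairing; any
    other contributes \<open>total U * ?P $ i $ j - U $ i $ j\<close>.\<close>
  moreover have "?R \<bullet> ?P = total U * total ?P - (\<Sum>i\<in>UNIV. \<Sum>j\<in>UNIV. if ?P $ i $ j = 0 then 0 else U $ i $ j)"
    unfolding inner_matrix total_def[of ?P] sum_distrib_left sum_subtractf[symmetric]
    by (intro sum.cong refl) (simp add: grad_matrix_def left_diff_distrib)
  ultimately have "total U = (\<Sum>i\<in>UNIV. \<Sum>j\<in>UNIV. if ?P $ i $ j = 0 then 0 else U $ i $ j)"
    using total_param_matrix[OF \<theta>] by simp
  also have "\<dots> = (\<Sum>(i, j)\<in>UNIV. if ?P $ i $ j = 0 then 0 else U $ i $ j)"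
    by (simp add: sum.cartesian_product)
  also have "\<dots> < (\<Sum>(i, j)\<in>UNIV. U $ i $ j)"
    using P0 U by (intro sum_strict_mono_ex1) (auto intro: less_imp_le bexI[of _ "(i, j)"])
  also have "\<dots> = total U"
    by (simp add: total_def sum.cartesian_product)
  finally show False by simp
qed

text \<open>Moving one factor along a line keeps the product form, hence rank at most r. Subtracting
  the multiple of \<open>A ** B\<close> keeps the entry sum at 1, so the whole line stays in the
  variety.\<close>

lemma tangent_space_product:
  fixes A :: "real^'r^'m" and B :: "real^'n^'r"
  assumes "total (A ** B) = 1" and "total (A ** Y) = s" and "total (Z ** B) = t"
  shows "A ** Y - s *\<^sub>R (A ** B) \<in> tangent_space (rank_variety CARD('r)) (A ** B)"
    and "Z ** B - t *\<^sub>R (A ** B) \<in> tangent_space (rank_variety CARD('r)) (A ** B)"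
proof -
  have "rank (C ** D) \<le> CARD('r)" for C :: "real^'r^'m" and D :: "real^'n^'r"
    by (meson min.boundedE order_trans rank_bound rank_mul_le_left)
  then have rank: "C ** D \<in> rank_variety CARD('r)" if "total (C ** D) = 1"
    for C :: "real^'r^'m" and D :: "real^'n^'r"
    using that by (simp add: rank_variety_def total_def)
  have total: "total (A ** B + c *\<^sub>R (W - u *\<^sub>R (A ** B))) = 1" if "total W = u" for c u W
    using assms(1) that by (simp add: total_eq_inner inner_add_left inner_diff_left)
  have "A ** B + c *\<^sub>R (A ** Y - s *\<^sub>R (A ** B)) = A ** (B + c *\<^sub>R (Y - s *\<^sub>R B))" for c
    by (simp add: vec_eq_iff matrix_matrix_mult_def algebra_simps sum.distrib sum_subtractf sum_distrib_left)
  then show "A ** Y - s *\<^sub>R (A ** B) \<in> tangent_space (rank_variety CARD('r)) (A ** B)"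
    using total[OF assms(2)] rank by (metis line_in_tangent_space)
  have "A ** B + c *\<^sub>R (Z ** B - t *\<^sub>R (A ** B)) = (A + c *\<^sub>R (Z - t *\<^sub>R A)) ** B" for c
    by (simp add: vec_eq_iff matrix_matrix_mult_def algebra_simps sum.distrib sum_subtractf sum_distrib_left)
  then show "Z ** B - t *\<^sub>R (A ** B) \<in> tangent_space (rank_variety CARD('r)) (A ** B)"
    using total[OF assms(3)] rank by (metis line_in_tangent_space)
qed

lemma loglik_gderiv:
  assumes "\<And>i j. 0 < P $ i $ j"
  shows "GDERIV (loglik U) P :> (\<chi> i j. U $ i $ j / P $ i $ j)"
proof -
  have "((\<lambda>Q. ln (Q $ i $ j)) has_derivative (\<lambda>H. H $ i $ j / P $ i $ j)) (at P)" for i j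
    using assms[of i j]
    by (auto intro!: derivative_eq_intros bounded_linear_imp_has_derivative
        bounded_linear_compose[OF bounded_linear_vec_nth] bounded_linear_vec_nth simp: field_simps)
  then have "((\<lambda>Q. \<Sum>i\<in>UNIV. \<Sum>j\<in>UNIV. U $ i $ j * ln (Q $ i $ j)) has_derivative
        (\<lambda>H. \<Sum>i\<in>UNIV. \<Sum>j\<in>UNIV. U $ i $ j * (H $ i $ j / P $ i $ j))) (at P)"
    by (intro has_derivative_sum has_derivative_mult_right)
  then show ?thesis
    by (simp add: gderiv_def loglik_def[abs_def] inner_matrix mult_ac)
qed

lemma gderiv_unique: "GDERIV f x :> D \<Longrightarrow> GDERIV f x :> E \<Longrightarrow> D = E"
  unfolding gderiv_def by (metis has_derivative_unique vector_eq_rdot inner_commute)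

lemma grad_matrix_eq:
  "grad_matrix U P = total U *\<^sub>R (\<chi> i j. 1) - (\<chi> i j. U $ i $ j / P $ i $ j)"
  by (simp add: grad_matrix_def vec_eq_iff)

text \<open>\<open>R\<close> is orthogonal to every \<open>Z ** B\<close> and every
  \<open>A ** Y\<close>; the choices \<open>Z = R ** transpose B\<close> and
  \<open>Y = transpose A ** R\<close> make the two squared norms vanish.\<close>

lemma critical_imp_likelihood_equations:
  fixes A :: "real^'r^'m" and B :: "real^'n^'r"
  assumes \<theta>: "(A, lam, B) \<in> Theta_pos" and P: "\<And>i j. 0 < param_matrix (A, lam, B) $ i $ j"
    and crit: "critical_param U (A, lam, B)"
  shows "grad_matrix U (param_matrix (A, lam, B)) ** transpose B = 0"
    and "transpose A ** grad_matrix U (param_matrix (A, lam, B)) = 0"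
proof -
  let ?P = "param_matrix (A, lam, B)"
  let ?R = "grad_matrix U ?P"
  define G where "G = (\<chi> i j. U $ i $ j / ?P $ i $ j)"
  have R: "?R = total U *\<^sub>R (\<chi> i j. 1) - G"
    by (simp add: grad_matrix_eq G_def)
  have orth: "G \<bullet> X = 0" if "X \<in> tangent_space (rank_variety CARD('r)) ?P" for X
  proof -
    obtain G' where G': "GDERIV (loglik U) ?P :> G'"
      "\<forall>X \<in> tangent_space (rank_variety CARD('r)) ?P. orthogonal G' X"
      using crit unfolding critical_param_def critical_point_def by blast
    have "G = G'"
      unfolding G_def by (rule gderiv_unique[OF loglik_gderiv[OF P] G'(1)])
    then show ?thesis
      using G'(2) that by (simp add: orthogonal_def)
  qed
  have "G \<bullet> ?P = total U"
    using P by (simp add: inner_matrix G_def total_def less_imp_neq[symmetric])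
  \<comment> \<open>Both \<open>?R \<bullet> W\<close> and
    \<open>- (G \<bullet> (W - total W *\<^sub>R ?P))\<close> equal
    \<open>total U * total W - G \<bullet> W\<close>.\<close>
  then have R0: "?R \<bullet> W = 0" if "W - total W *\<^sub>R ?P \<in> tangent_space (rank_variety CARD('r)) ?P" for W
    using orth[OF that]
    by (simp add: R inner_diff_left inner_diff_right total_eq_inner[of W] inner_commute)
  \<comment> \<open>Absorbing the diagonal matrix into the left or the right factor leaves
    \<open>B\<close> or \<open>A\<close> itself as the factor that is kept fixed.\<close>
  have PAB: "?P = (A ** diag lam) ** B" "?P = A ** (diag lam ** B)"
    by (simp_all add: param_matrix_def matrix_mul_assoc)
  note total = total_param_matrix[OF \<theta>]
  have "?R \<bullet> (Z ** B) = 0" for Z :: "real^'r^'m"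
    using R0 tangent_space_product(2)[of "A ** diag lam" B, OF _ refl refl] total
    by (metis PAB(1))
  then have "(?R ** transpose B) \<bullet> (?R ** transpose B) = 0"
    by (simp only: inner_matrix_mul_right[symmetric])
  then show "?R ** transpose B = 0" by simp
  have "?R \<bullet> (A ** Y) = 0" for Y :: "real^'n^'r"
    using R0 tangent_space_product(1)[of A "diag lam ** B", OF _ refl refl] total
    by (metis PAB(2))
  then have "(transpose A ** ?R) \<bullet> (transpose A ** ?R) = 0"
    by (simp only: inner_matrix_mul_left[symmetric])
  then show "transpose A ** ?R = 0" by simp
qed

text \<open>Rank r of the product forces \<open>A\<close> and \<open>transpose B\<close> to be
  injective, and positive \<open>lam\<close> does so for \<open>diag lam\<close>. So a tangent
  vector is orthogonal to \<open>R\<close>, and to the all-ones matrix since its entries sum to 0;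
  the gradient is a combination of these two.\<close>

lemma likelihood_equations_imp_critical:
  fixes A :: "real^'r^'m" and B :: "real^'n^'r"
  assumes \<theta>: "(A, lam, B) \<in> Theta_pos" and P: "\<And>i j. 0 < param_matrix (A, lam, B) $ i $ j"
    and rank: "rank (param_matrix (A, lam, B)) = CARD('r)"
    and RB: "grad_matrix U (param_matrix (A, lam, B)) ** transpose B = 0"
    and AR: "transpose A ** grad_matrix U (param_matrix (A, lam, B)) = 0"
  shows "critical_param U (A, lam, B)"
proof -
  let ?P = "param_matrix (A, lam, B)"
  let ?R = "grad_matrix U ?P"
  have PAB: "?P = A ** diag lam ** B"
    by (simp add: param_matrix_def)
  have "CARD('r) \<le> rank A"
    using rank unfolding PAB by (metis rank_mul_le_left matrix_mul_assoc)
  then have A: "inj ((*v) A)"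
    using rank_bound[of A] by (simp add: full_rank_injective[symmetric])
  have "CARD('r) \<le> rank B"
    using rank unfolding PAB by (metis rank_mul_le_right)
  then have B: "inj ((*v) (transpose B))"
    using rank_bound[of B] by (simp add: full_rank_injective[symmetric] rank_transpose)
  have "diag lam *v w = (\<chi> k. lam $ k * w $ k)" for w
    by (simp add: vec_eq_iff diag_def matrix_vector_mult_def if_distrib if_distribR cong: if_cong)
  then have D: "inj ((*v) (diag lam))"
    using \<theta> by (intro injI) (auto simp: vec_eq_iff Theta_pos_iff, metis less_irrefl)
  have "(\<chi> i j. U $ i $ j / ?P $ i $ j) \<bullet> X = 0"
    if X: "X \<in> tangent_space (rank_variety CARD('r)) ?P" for X
  proof -
    have "?R \<bullet> X = 0"
      using X tangent_rank_variety_kernels[OF A D B]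
      by (intro inner_eq_0_of_kernels[OF A B RB AR]) (auto simp: PAB)
    moreover have "(\<chi> i j. 1) \<bullet> X = 0"
      using tangent_rank_variety_total[OF X] by (simp add: total_eq_inner inner_commute)
    ultimately show ?thesis
      by (simp add: grad_matrix_eq inner_diff_left)
  qed
  moreover have "?P \<in> model TYPE('r)"
    using \<theta> by (auto simp: model_def Theta_pos_def)
  ultimately show ?thesis
    using rank loglik_gderiv[OF P]
    unfolding critical_param_def critical_point_def orthogonal_def by blast
qed

subsection \<open>Fixed points of the EM step\<close>

lemma em_step_simps:
  fixes U :: "real^'n^'m" and \<theta> :: "('m, 'r::finite, 'n) param"
  defines "v \<equiv> e_step U \<theta>"
  shows "fst (snd (em_step U \<theta>)) $ k = (\<Sum>i\<in>UNIV. \<Sum>j\<in>UNIV. v i k j) / total U"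
    and "fst (em_step U \<theta>) $ i $ k =
           (\<Sum>j\<in>UNIV. v i k j) / (total U * fst (snd (em_step U \<theta>)) $ k)"
    and "snd (snd (em_step U \<theta>)) $ k $ j =
           (\<Sum>i\<in>UNIV. v i k j) / (total U * fst (snd (em_step U \<theta>)) $ k)"
  by (simp_all add: em_step_def m_step_def v_def Let_def)

lemma e_step_eq:
  "e_step U (A, lam, B) i k j =
     A $ i $ k * lam $ k * B $ k $ j / param_matrix (A, lam, B) $ i $ j * U $ i $ j"
  by (simp add: e_step_def param_matrix_nth)

text \<open>The E-step splits \<open>U $ i $ j\<close> in proportion to the summands of the matrix
  entry. Where that entry is 0 the whole mass is lost, by the convention for division by
  zero.\<close>

lemma sum_e_step:
  "(\<Sum>k\<in>UNIV. e_step U (A, lam, B) i k j) =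
     (if param_matrix (A, lam, B) $ i $ j = 0 then 0 else U $ i $ j)"
  by (simp add: e_step_eq param_matrix_nth flip: sum_divide_distrib sum_distrib_right)

text \<open>Iterates may leave \<open>Theta_pos\<close>: mass lost in the E-step lowers the sum of
  \<open>lam\<close>, and some \<open>lam $ k\<close> may become 0. Nonnegativity survives every
  step.\<close>

definition param_nonneg :: "('m::finite, 'r::finite, 'n::finite) param \<Rightarrow> bool" where
  "param_nonneg = (\<lambda>(A, lam, B).
     (\<forall>i k. 0 \<le> A $ i $ k) \<and> (\<forall>k. 0 \<le> lam $ k) \<and> (\<forall>k j. 0 \<le> B $ k $ j))"

lemma e_step_nonneg:
  assumes "\<And>i j. 0 < U $ i $ j" and "param_nonneg \<theta>"
  shows "0 \<le> e_step U \<theta> i k j"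
  using assms by (cases \<theta>)
    (auto simp: e_step_def param_nonneg_def less_imp_le
      intro!: mult_nonneg_nonneg divide_nonneg_nonneg sum_nonneg)

lemma total_pos:
  fixes U :: "real^'n^'m"
  assumes "\<And>i j. 0 < U $ i $ j"
  shows "0 < total U"
  using assms by (auto simp: total_def intro!: sum_pos)

lemma em_step_nonneg:
  assumes U: "\<And>i j. 0 < U $ i $ j" and \<theta>: "param_nonneg \<theta>"
  shows "param_nonneg (em_step U \<theta>)"
proof -
  have lam: "0 \<le> fst (snd (em_step U \<theta>)) $ k" for k
    unfolding em_step_simps
    using total_pos[OF U] by (intro divide_nonneg_pos sum_nonneg e_step_nonneg[OF U \<theta>])
  have "0 \<le> fst (em_step U \<theta>) $ i $ k" "0 \<le> snd (snd (em_step U \<theta>)) $ k $ j" for i k j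
    unfolding em_step_simps(2,3) using total_pos[OF U] lam[of k]
    by (intro divide_nonneg_nonneg sum_nonneg e_step_nonneg[OF U \<theta>] mult_nonneg_nonneg; simp)+
  then show ?thesis
    using lam by (auto simp: param_nonneg_def split: prod.split)
qed

text \<open>Multiplied by \<open>lam $ k\<close>, the equations give the row and column sums of the
  E-step. Summing over i with column sum 1 recovers \<open>lam\<close>, and the M-step quotients
  then cancel.\<close>

lemma em_step_fixed:
  fixes U :: "real^'n^'m" and A :: "real^'r^'m"
  assumes U: "\<And>i j. 0 < U $ i $ j" and \<theta>: "(A, lam, B) \<in> Theta_pos"
    and eqA: "\<And>i k. A $ i $ k * (\<Sum>j\<in>UNIV. U $ i $ j / param_matrix (A, lam, B) $ i $ j * B $ k $ j)
                = A $ i $ k * total U"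
    and eqB: "\<And>k j. B $ k $ j * (\<Sum>i\<in>UNIV. U $ i $ j / param_matrix (A, lam, B) $ i $ j * A $ i $ k)
                = B $ k $ j * total U"
  shows "em_step U (A, lam, B) = (A, lam, B)"
proof -
  let ?v = "e_step U (A, lam, B)"
  have lam: "lam $ k \<noteq> 0" for k
    using \<theta> by (simp add: Theta_pos_iff less_imp_neq[symmetric])
  have tot: "total U \<noteq> 0"
    using total_pos[OF U] by simp
  have vA: "(\<Sum>j\<in>UNIV. ?v i k j) = total U * lam $ k * A $ i $ k" for i k
  proof -
    have "(\<Sum>j\<in>UNIV. ?v i k j) =
        lam $ k * (A $ i $ k * (\<Sum>j\<in>UNIV. U $ i $ j / param_matrix (A, lam, B) $ i $ j * B $ k $ j))"
      by (simp add: e_step_eq sum_distrib_left mult_ac)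
    then show ?thesis unfolding eqA by (simp add: mult_ac)
  qed
  have vB: "(\<Sum>i\<in>UNIV. ?v i k j) = total U * lam $ k * B $ k $ j" for k j
  proof -
    have "(\<Sum>i\<in>UNIV. ?v i k j) =
        lam $ k * (B $ k $ j * (\<Sum>i\<in>UNIV. U $ i $ j / param_matrix (A, lam, B) $ i $ j * A $ i $ k))"
      by (simp add: e_step_eq sum_distrib_left mult_ac)
    then show ?thesis unfolding eqB by (simp add: mult_ac)
  qed
  have L: "fst (snd (em_step U (A, lam, B))) $ k = lam $ k" for k
    using \<theta> tot unfolding em_step_simps vA
    by (simp add: Theta_pos_iff flip: sum_distrib_left)
  show ?thesis
    by (intro prod_eqI) (simp_all add: vec_eq_iff L em_step_simps(2,3) vA vB lam tot)
qed

text \<open>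
  The M-step turns \<open>v_ikj\<close> into column and row masses of the next iterate, so \<open>v_ikj \<longlonglongrightarrow> 0\<close> at
  positions where the limit has \<open>a_ik b_kj = 0\<close>. On the other hand the masses \<open>\<lambda>_k\<close> of the
  limit add up to 1, which forces \<open>\<Sum>\<^sub>k v_ikj \<longlonglongrightarrow> u_ij\<close>. Hence no entry of \<open>P\<close> vanishes in the limit.
\<close>

lemma em_limit:
  fixes U :: "real^'n^'m" and A :: "real^'r^'m"
  assumes U: "\<And>i j. 0 < U $ i $ j" and \<theta>: "(A, lam, B) \<in> Theta_pos"
    and \<theta>0: "param_nonneg \<theta>0"
    and lim: "(\<lambda>t. (em_step U ^^ t) \<theta>0) \<longlonglongrightarrow> (A, lam, B)"
  shows "A $ i $ k * (\<Sum>j\<in>UNIV. U $ i $ j / param_matrix (A, lam, B) $ i $ j * B $ k $ j)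
           = A $ i $ k * total U"
    and "B $ k $ j * (\<Sum>i\<in>UNIV. U $ i $ j / param_matrix (A, lam, B) $ i $ j * A $ i $ k)
           = B $ k $ j * total U"
proof -
  define a where "a t = fst ((em_step U ^^ t) \<theta>0)" for t
  define l where "l t = fst (snd ((em_step U ^^ t) \<theta>0))" for t
  define b where "b t = snd (snd ((em_step U ^^ t) \<theta>0))" for t
  define v where "v t = e_step U (a t, l t, b t)" for t
  let ?P = "param_matrix (A, lam, B)"
  have iter: "(em_step U ^^ t) \<theta>0 = (a t, l t, b t)" for t
    by (simp add: a_def l_def b_def)
  have "param_nonneg ((em_step U ^^ t) \<theta>0)" for t
    by (induction t) (simp_all add: \<theta>0 em_step_nonneg[OF U])
  then have v_nonneg: "0 \<le> v t i k j" for t i k j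
    unfolding v_def iter by (intro e_step_nonneg[OF U])
  have a: "(\<lambda>t. a t $ i $ k) \<longlonglongrightarrow> A $ i $ k" for i k
    using tendsto_fst[OF lim] by (simp add: a_def[symmetric] tendsto_vec_nth)
  have l: "(\<lambda>t. l t $ k) \<longlonglongrightarrow> lam $ k" for k
    using tendsto_fst[OF tendsto_snd[OF lim]] by (simp add: l_def[symmetric] tendsto_vec_nth)
  have b: "(\<lambda>t. b t $ k $ j) \<longlonglongrightarrow> B $ k $ j" for k j
    using tendsto_snd[OF tendsto_snd[OF lim]] by (simp add: b_def[symmetric] tendsto_vec_nth)
  have lam: "0 < lam $ k" for k
    using \<theta> by (simp add: Theta_pos_iff)
  have tot: "0 < total U"
    by (rule total_pos[OF U])
  \<comment> \<open>The index shift matters: \<open>v t\<close> is computed from iterate t and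
    determines iterate \<open>Suc t\<close>.\<close>
  have Suc: "(a (Suc t), l (Suc t), b (Suc t)) = em_step U (a t, l t, b t)" for t
    by (simp add: iter[symmetric])
  have l_Suc: "l (Suc t) $ k = (\<Sum>i\<in>UNIV. \<Sum>j\<in>UNIV. v t i k j) / total U" for t k
    using em_step_simps(1)[of U "(a t, l t, b t)" k] by (simp add: v_def flip: Suc)
  have a_Suc: "a (Suc t) $ i $ k = (\<Sum>j\<in>UNIV. v t i k j) / (total U * l (Suc t) $ k)" for t i k
    using em_step_simps(2)[of U "(a t, l t, b t)" i k] by (simp add: v_def flip: Suc)
  have b_Suc: "b (Suc t) $ k $ j = (\<Sum>i\<in>UNIV. v t i k j) / (total U * l (Suc t) $ k)" for t k j
    using em_step_simps(3)[of U "(a t, l t, b t)" k j] by (simp add: v_def flip: Suc)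
  have squeeze: "f \<longlonglongrightarrow> 0" if "\<And>t. 0 \<le> f t" "\<And>t. f t \<le> g t" "g \<longlonglongrightarrow> 0"
    for f g :: "nat \<Rightarrow> real"
    by (rule tendsto_sandwich[OF _ _ tendsto_const that(3)]) (simp_all add: that)
  \<comment> \<open>Only eventually, since an early iterate may have a zero weight; this is what
    permits clearing the M-step denominators in the limit.\<close>
  have l_nz: "\<forall>\<^sub>F t in sequentially. l (Suc t) $ k \<noteq> 0" for k
    using order_tendstoD(1)[OF LIMSEQ_Suc[OF l[of k]] lam[of k]] by eventually_elim simp
  have va: "(\<lambda>t. \<Sum>j\<in>UNIV. v t i k j) \<longlonglongrightarrow> total U * lam $ k * A $ i $ k" for i k
  proof (rule Lim_transform_eventually)
    show "(\<lambda>t. total U * l (Suc t) $ k * a (Suc t) $ i $ k) \<longlonglongrightarrow> total U * lam $ k * A $ i $ k"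
      by (intro tendsto_intros LIMSEQ_Suc[OF l] LIMSEQ_Suc[OF a])
    show "\<forall>\<^sub>F t in sequentially. total U * l (Suc t) $ k * a (Suc t) $ i $ k = (\<Sum>j\<in>UNIV. v t i k j)"
      using l_nz[of k] by eventually_elim (use tot in \<open>simp add: a_Suc\<close>)
  qed
  have vb: "(\<lambda>t. \<Sum>i\<in>UNIV. v t i k j) \<longlonglongrightarrow> total U * lam $ k * B $ k $ j" for k j
  proof (rule Lim_transform_eventually)
    show "(\<lambda>t. total U * l (Suc t) $ k * b (Suc t) $ k $ j) \<longlonglongrightarrow> total U * lam $ k * B $ k $ j"
      by (intro tendsto_intros LIMSEQ_Suc[OF l] LIMSEQ_Suc[OF b])
    show "\<forall>\<^sub>F t in sequentially. total U * l (Suc t) $ k * b (Suc t) $ k $ j = (\<Sum>i\<in>UNIV. v t i k j)"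
      using l_nz[of k] by eventually_elim (use tot in \<open>simp add: b_Suc\<close>)
  qed
  have vu: "(\<lambda>t. \<Sum>k\<in>UNIV. v t i k j) \<longlonglongrightarrow> U $ i $ j" for i j
  proof -
    \<comment> \<open>\<open>w t i j\<close> is the mass of \<open>U $ i $ j\<close> lost in E-step
      t. It is nonnegative, and its sum over all entries is \<open>total U\<close> times the defect
      of the next weights from 1, which tends to 0.\<close>
    define w where "w t i j = U $ i $ j - (\<Sum>k\<in>UNIV. v t i k j)" for t i j
    have w_nonneg: "0 \<le> w t i j" for t i j
      using U[of i j] by (simp add: w_def v_def sum_e_step)
    have "(\<Sum>i\<in>UNIV. \<Sum>j\<in>UNIV. \<Sum>k\<in>UNIV. v t i k j) = (\<Sum>k\<in>UNIV. \<Sum>i\<in>UNIV. \<Sum>j\<in>UNIV. v t i k j)" for t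
      by (subst (3) sum.swap, subst (2) sum.swap) (rule refl)
    then have "(\<Sum>i\<in>UNIV. \<Sum>j\<in>UNIV. w t i j) = total U - total U * (\<Sum>k\<in>UNIV. l (Suc t) $ k)" for t
      using tot by (simp add: w_def sum_subtractf total_def[of U] l_Suc flip: sum_divide_distrib)
    moreover have "(\<lambda>t. total U - total U * (\<Sum>k\<in>UNIV. l (Suc t) $ k))
        \<longlonglongrightarrow> total U - total U * (\<Sum>k\<in>UNIV. lam $ k)"
      by (intro tendsto_intros LIMSEQ_Suc[OF l])
    ultimately have w_sum: "(\<lambda>t. \<Sum>i\<in>UNIV. \<Sum>j\<in>UNIV. w t i j) \<longlonglongrightarrow> 0"
      using \<theta> by (simp add: Theta_pos_iff)
    have w_le: "w t i j \<le> (\<Sum>i\<in>UNIV. \<Sum>j\<in>UNIV. w t i j)" for t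
    proof -
      have "w t i j \<le> (\<Sum>j\<in>UNIV. w t i j)"
        by (rule member_le_sum[where f = "w t i"]) (auto simp: w_nonneg)
      also have "\<dots> \<le> (\<Sum>i\<in>UNIV. \<Sum>j\<in>UNIV. w t i j)"
        by (rule member_le_sum[where f = "\<lambda>i. \<Sum>j\<in>UNIV. w t i j"]) (auto simp: w_nonneg sum_nonneg)
      finally show ?thesis .
    qed
    have "(\<lambda>t. w t i j) \<longlonglongrightarrow> 0"
      by (rule squeeze[OF w_nonneg w_le w_sum])
    from tendsto_diff[OF tendsto_const[of "U $ i $ j"] this] show ?thesis
      by (simp add: w_def)
  qed
  have P: "?P $ i $ j \<noteq> 0" for i j
  proof
    assume P0: "?P $ i $ j = 0"
    have "(\<lambda>t. v t i k j) \<longlonglongrightarrow> 0" for k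
    proof -
      have "A $ i $ k * lam $ k * B $ k $ j = 0"
        using P0 \<theta> unfolding param_matrix_nth
        by (subst (asm) sum_nonneg_eq_0_iff) (auto simp: Theta_pos_iff less_imp_le)
      then consider "A $ i $ k = 0" | "B $ k $ j = 0"
        using lam[of k] by auto
      then show ?thesis
      proof cases
        case 1
        then have lim0: "(\<lambda>t. \<Sum>j\<in>UNIV. v t i k j) \<longlonglongrightarrow> 0"
          using va[of i k] by simp
        have le: "v t i k j \<le> (\<Sum>j\<in>UNIV. v t i k j)" for t
          by (rule member_le_sum[where f = "v t i k"]) (auto simp: v_nonneg)
        show ?thesis
          by (rule squeeze[OF v_nonneg le lim0])
      next
        case 2
        then have lim0: "(\<lambda>t. \<Sum>i\<in>UNIV. v t i k j) \<longlonglongrightarrow> 0"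
          using vb[of k j] by simp
        have le: "v t i k j \<le> (\<Sum>i\<in>UNIV. v t i k j)" for t
          by (rule member_le_sum[where f = "\<lambda>i. v t i k j"]) (auto simp: v_nonneg)
        show ?thesis
          by (rule squeeze[OF v_nonneg le lim0])
      qed
    qed
    then have "(\<lambda>t. \<Sum>k\<in>UNIV. v t i k j) \<longlonglongrightarrow> (\<Sum>k\<in>(UNIV :: 'r set). 0)"
      by (intro tendsto_sum)
    then have "U $ i $ j = 0"
      using vu LIMSEQ_unique by fastforce
    then show False
      using U[of i j] by simp
  qed
  \<comment> \<open>With nonzero denominators the E-step is continuous at the limit; comparing with
    \<open>va\<close> and \<open>vb\<close> yields the fixed point equations.\<close>
  have v: "(\<lambda>t. v t i k j) \<longlonglongrightarrow> A $ i $ k * lam $ k * B $ k $ j / ?P $ i $ j * U $ i $ j" for i k j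
  proof -
    have "(\<lambda>t. param_matrix (a t, l t, b t) $ i $ j) \<longlonglongrightarrow> ?P $ i $ j"
      unfolding param_matrix_nth by (intro tendsto_intros a b l)
    then show ?thesis
      unfolding v_def e_step_eq by (intro tendsto_mult tendsto_divide tendsto_const a b l P)
  qed
  have "(\<Sum>j\<in>UNIV. A $ i $ k * lam $ k * B $ k $ j / ?P $ i $ j * U $ i $ j) = total U * lam $ k * A $ i $ k"
    by (rule LIMSEQ_unique[OF _ va]) (intro tendsto_sum v)
  then have "lam $ k * (A $ i $ k * (\<Sum>j\<in>UNIV. U $ i $ j / ?P $ i $ j * B $ k $ j)) =
      lam $ k * (A $ i $ k * total U)"
    by (simp add: sum_distrib_left mult_ac)
  then show "A $ i $ k * (\<Sum>j\<in>UNIV. U $ i $ j / ?P $ i $ j * B $ k $ j) = A $ i $ k * total U"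
    using lam[of k] by simp
  have "(\<Sum>i\<in>UNIV. A $ i $ k * lam $ k * B $ k $ j / ?P $ i $ j * U $ i $ j) = total U * lam $ k * B $ k $ j"
    by (rule LIMSEQ_unique[OF _ vb]) (intro tendsto_sum v)
  then have "lam $ k * (B $ k $ j * (\<Sum>i\<in>UNIV. U $ i $ j / ?P $ i $ j * A $ i $ k)) =
      lam $ k * (B $ k $ j * total U)"
    by (simp add: sum_distrib_left mult_ac)
  then show "B $ k $ j * (\<Sum>i\<in>UNIV. U $ i $ j / ?P $ i $ j * A $ i $ k) = B $ k $ j * total U"
    using lam[of k] by simp
qed

text \<open>Limits satisfy the equations by \<open>em_limit\<close>; conversely a solution is fixed
  by the EM step, so the constant sequence started there converges to it.\<close>

lemma em_fixed_point_iff: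
  fixes U :: "real^'n^'m" and A :: "real^'r^'m"
  assumes U: "\<And>i j. 0 < U $ i $ j"
  shows "em_fixed_point U (A, lam, B) \<longleftrightarrow> (A, lam, B) \<in> Theta_pos \<and>
    (let R = grad_matrix U (param_matrix (A, lam, B)) in
       A \<star> (R ** transpose B) = 0 \<and> B \<star> (transpose A ** R) = 0)"
proof (cases "(A, lam, B) \<in> Theta_pos")
  case True
  let ?P = "param_matrix (A, lam, B)"
  have eqA: "A \<star> (grad_matrix U ?P ** transpose B) = 0 \<longleftrightarrow>
      (\<forall>i k. A $ i $ k * (\<Sum>j\<in>UNIV. U $ i $ j / ?P $ i $ j * B $ k $ j) = A $ i $ k * total U)"
    using True by (simp add: vec_eq_iff grad_matrix_mul_nth Theta_pos_iff
        eq_commute[of "total U" "sum f S" for f S])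
  have eqB: "B \<star> (transpose A ** grad_matrix U ?P) = 0 \<longleftrightarrow>
      (\<forall>k j. B $ k $ j * (\<Sum>i\<in>UNIV. U $ i $ j / ?P $ i $ j * A $ i $ k) = B $ k $ j * total U)"
    using True by (simp add: vec_eq_iff mul_grad_matrix_nth Theta_pos_iff
        eq_commute[of "total U" "sum f S" for f S])
  show ?thesis
  proof
    assume "em_fixed_point U (A, lam, B)"
    then obtain \<theta>0 where \<theta>0: "\<theta>0 \<in> Theta_pos" "(\<lambda>t. (em_step U ^^ t) \<theta>0) \<longlonglongrightarrow> (A, lam, B)"
      by (auto simp: em_fixed_point_def)
    have "param_nonneg \<theta>0"
      using \<theta>0(1) by (cases \<theta>0) (auto simp: param_nonneg_def Theta_pos_iff less_imp_le)
    then show "(A, lam, B) \<in> Theta_pos \<and> (let R = grad_matrix U ?P in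
       A \<star> (R ** transpose B) = 0 \<and> B \<star> (transpose A ** R) = 0)"
      unfolding Let_def eqA eqB using True em_limit[OF U True _ \<theta>0(2)] by blast
  next
    assume "(A, lam, B) \<in> Theta_pos \<and> (let R = grad_matrix U ?P in
       A \<star> (R ** transpose B) = 0 \<and> B \<star> (transpose A ** R) = 0)"
    then have "em_step U (A, lam, B) = (A, lam, B)"
      unfolding Let_def eqA eqB using em_step_fixed[OF U] by blast
    then have "(em_step U ^^ t) (A, lam, B) = (A, lam, B)" for t
      by (induction t) simp_all
    then show "em_fixed_point U (A, lam, B)"
      unfolding em_fixed_point_def using True by (auto intro!: bexI[of _ "(A, lam, B)"])
  qed
qed (simp add: em_fixed_point_def)

text \<open>In both directions the first Hadamard equation makes the matrix positive, so that the
  log-likelihood has a gradient. The rank condition is separate: for U of rank one and r at least 2,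
  the matrix U divided by its total has R = 0 but rank below r.\<close>

lemma critical_em_fixed_point_iff:
  fixes U :: "real^'n^'m" and A :: "real^'r^'m"
  assumes U: "\<And>i j. 0 < U $ i $ j"
  shows "em_fixed_point U (A, lam, B) \<and> critical_param U (A, lam, B) \<longleftrightarrow>
    (A, lam, B) \<in> Theta_pos \<and> rank (param_matrix (A, lam, B)) = CARD('r) \<and>
    (let R = grad_matrix U (param_matrix (A, lam, B)) in R ** transpose B = 0 \<and> transpose A ** R = 0)"
    (is "?L \<longleftrightarrow> ?R")
proof
  assume ?L
  then have \<theta>: "(A, lam, B) \<in> Theta_pos"
    and eq: "A \<star> (grad_matrix U (param_matrix (A, lam, B)) ** transpose B) = 0"
    and crit: "critical_param U (A, lam, B)"
    by (simp_all add: em_fixed_point_iff[OF U] Let_def)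
  show ?R
    using \<theta> crit critical_imp_likelihood_equations[OF \<theta> hadamard_imp_positive[OF U \<theta> eq] crit]
    by (simp add: critical_param_def critical_point_def Let_def)
next
  assume R: ?R
  then have fixed: "em_fixed_point U (A, lam, B)"
    by (simp add: em_fixed_point_iff[OF U] Let_def)
  have \<theta>: "(A, lam, B) \<in> Theta_pos"
    and eq: "A \<star> (grad_matrix U (param_matrix (A, lam, B)) ** transpose B) = 0"
    using R by (simp_all add: Let_def)
  show ?L
    using fixed R likelihood_equations_imp_critical[OF \<theta> hadamard_imp_positive[OF U \<theta> eq]]
    by (simp add: Let_def)
qed

theorem theorem3p5:
  fixes U :: "real^'n^'m"
  assumes U_pos: "\<And>i j. 0 < U $ i $ j"
  shows "{\<theta> :: ('m, 'r::finite, 'n) param. em_fixed_point U \<theta>} =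
         {(A, lam, B) | A lam B.
            (A, lam, B) \<in> Theta_pos \<and>
            (let R = grad_matrix U (param_matrix (A, lam, B)) in
               A \<star> (R ** transpose B) = 0 \<and> B \<star> (transpose A ** R) = 0)}
         \<and>
         {\<theta> :: ('m, 'r, 'n) param. em_fixed_point U \<theta> \<and> critical_param U \<theta>} =
         {(A, lam, B) | A lam B.
            (A, lam, B) \<in> Theta_pos \<and>
            rank (param_matrix (A, lam, B)) = CARD('r) \<and>
            (let R = grad_matrix U (param_matrix (A, lam, B)) in
               R ** transpose B = 0 \<and> transpose A ** R = 0)}"
proof (intro conjI set_eqI)
  fix \<theta> :: "('m, 'r, 'n) param"
  obtain A lam B where \<theta>: "\<theta> = (A, lam, B)"
    by (cases \<theta>)
  show "\<theta> \<in> {\<theta>. em_fixed_point U \<theta>} \<longleftrightarrow> \<theta> \<in> {(A, lam, B) | A lam B.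
            (A, lam, B) \<in> Theta_pos \<and>
            (let R = grad_matrix U (param_matrix (A, lam, B)) in
               A \<star> (R ** transpose B) = 0 \<and> B \<star> (transpose A ** R) = 0)}"
    unfolding \<theta> using em_fixed_point_iff[OF U_pos, of A lam B] by simp
  show "\<theta> \<in> {\<theta>. em_fixed_point U \<theta> \<and> critical_param U \<theta>} \<longleftrightarrow> \<theta> \<in> {(A, lam, B) | A lam B.
            (A, lam, B) \<in> Theta_pos \<and>
            rank (param_matrix (A, lam, B)) = CARD('r) \<and>
            (let R = grad_matrix U (param_matrix (A, lam, B)) in
               R ** transpose B = 0 \<and> transpose A ** R = 0)}"
    unfolding \<theta> using critical_em_fixed_point_iff[OF U_pos, of A lam B] by simp
qed

end
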